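(* For every $t\in(0,\infty)$, the Rips magnitudes of the Euclidean cycles $C_n^{\mathrm{eucl}}$ satisfy $$\liminf_{n\to\infty}|tC^{\mathrm{eucl}}_n|_{\mathrm{Rips}}=e^{-2t}+2\pi t$$ and $$\limsup_{n\to\infty}|tC^{\mathrm{eucl}}_n|_{\mathrm{Rips}}=e^{-2t}+2\pi t\sum_{r\text{ odd}}\frac1r\,e^{-2t\cos\left(\frac\pi{2r}\right)}\sin\left(\frac\pi{2r}\right),$$ where the sum is over all positive odd integers $r$. This series converges absolutely, since its $r$-th term is bounded above by $\frac{\pi}{2r^2}$.
   Context: $C_n^{\mathrm{eucl}}$ denotes the set of $n$ equidistant points on the unit circle in $\mathbb{R}^2$ with the Euclidean metric. For a finite metric space $X$, the Rips magnitude function $|tX|_{\mathrm{Rips}}$ is the persistent magnitude function of the persistent homology of its Vietoris–Rips complex; equivalently, it is given for $t\in(0,\infty)$ by $|tX|_{\mathrm{Rips}}=\sum_{\emptyset\ne A\subseteq X}(-1)^{\#A-1}e^{-\mathrm{diam}(A)t}$. *)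

theory Defs
  imports "HOL-Analysis.Analysis"
begin

text \<open>
  The Rips magnitude function \<open>t \<mapsto> |tX|\<close> of a finite metric space \<open>X\<close> (here a finite subset of an
  ambient metric space), written out as the alternating sum over the nonempty simplices \<open>A \<subseteq> X\<close> of
  the full simplex on \<open>X\<close>, where \<open>A\<close> enters the Vietoris-Rips filtration at scale \<open>diameter A\<close>.
\<close>

definition rips_magnitude :: "'a::metric_space set \<Rightarrow> real \<Rightarrow> real" where
  "rips_magnitude X t =
     (\<Sum>A | A \<noteq> {} \<and> A \<subseteq> X. (- 1) ^ (card A - 1) * exp (- diameter A * t))"

definition euclidean_cycle :: "nat \<Rightarrow> (real ^ 2) set" where
  "euclidean_cycle n =
     (\<lambda>k. vector [cos (2 * pi * real k / real n), sin (2 * pi * real k / real n)]) ` {..<n}"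

end

theory Submission
  imports Defs
begin

text \<open>
  The simplices of diameter at most \<open>2 sin (\<pi> r / n)\<close> are the cliques of the circulant graph joining
  points at circular distance at most \<open>r\<close>. For \<open>2 r + 2 \<le> n\<close> the Euler characteristic of this clique
  complex is \<open>m = n - 2 r\<close> if \<open>m\<close> divides \<open>r\<close>, and \<open>0\<close> otherwise: toggling the successor of a suitable
  canonical point is a sign-reversing involution, and the cliques it leaves over are exactly
  the residue classes modulo \<open>m\<close>. Summation by parts over the scale \<open>r\<close>, with \<open>k = n / m\<close> running
  through the odd divisors of \<open>n\<close>, gives
  \<open>|t C\<^sub>n| = exp (-2 t sin (\<pi> \<lfloor>n/2\<rfloor> / n)) + \<Sum>\<^sub>k n/k (h (\<pi>/2k) - h (\<pi>/2k - \<pi>/n))\<close> for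
  \<open>h x = exp (-2 t cos x)\<close>. As \<open>h'\<close> is nonnegative and increasing on \<open>[0, \<pi>/2]\<close>,
  every summand is nonnegative and at most its limit \<open>(\<pi>/k) h' (\<pi>/2k)\<close>. The lower limit is attained along powers of two, where only \<open>k = 1\<close>
  contributes, and the upper limit along multiples of more and more odd numbers.
\<close>

section \<open>Cliques of circulant graphs\<close>

text \<open>
  A set \<open>A \<subseteq> {0..<n}\<close> stands for the \<open>n\<close>-periodic set of integers \<open>z\<close> with \<open>z mod n \<in> A\<close>. Its
  elements have pairwise circular distance at most \<open>r\<close> iff no difference lies strictly between
  \<open>r\<close> and \<open>n - r\<close>.
\<close>

definition cyclic_clique :: "int \<Rightarrow> int \<Rightarrow> int set \<Rightarrow> bool" where
  "cyclic_clique n r A \<longleftrightarrow>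
     (\<forall>u v. u mod n \<in> A \<longrightarrow> v mod n \<in> A \<longrightarrow> \<not> (r < v - u \<and> v - u < n - r))"

text \<open>
  Put the points of \<open>A\<close> and their antipodes on one circle: a block is a maximal run of points of \<open>A\<close>
  with no antipode in between. For a clique with \<open>2 * r + 2 \<le> n\<close>, \<open>x \<in> A\<close> begins a block iff no
  \<open>a \<in> A\<close> shortly before \<open>x\<close> sees all that \<open>x\<close> sees within distance \<open>r\<close> ahead.
\<close>

definition block_start :: "int \<Rightarrow> int \<Rightarrow> int set \<Rightarrow> int \<Rightarrow> bool" where
  "block_start n r A x \<longleftrightarrow> x mod n \<in> A \<and>
     (\<forall>a. a mod n \<in> A \<longrightarrow> x - r \<le> a \<longrightarrow> a < x \<longrightarrow>
        (\<exists>b. b mod n \<in> A \<and> x \<le> b \<and> b \<le> x + r \<and> a + r < b))"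

text \<open>
  The block starts \<open>x\<close> for which \<open>x + 1\<close> may be inserted without leaving the cliques: the only
  possible obstruction is the point \<open>x - r\<close>.
\<close>

definition free_starts :: "int \<Rightarrow> int \<Rightarrow> int set \<Rightarrow> int set" where
  "free_starts n r A = {x \<in> {0..<n}. block_start n r A x \<and> (x - r) mod n \<notin> A}"

section \<open>Cliques, block starts and insertion of a successor\<close>

lemma cyclic_cliqueD:
  "cyclic_clique n r A \<Longrightarrow> u mod n \<in> A \<Longrightarrow> v mod n \<in> A \<Longrightarrow> r < v - u \<Longrightarrow> v - u < n - r \<Longrightarrow> False"
  by (auto simp: cyclic_clique_def)

lemma cyclic_clique_subset: "cyclic_clique n r B \<Longrightarrow> A \<subseteq> B \<Longrightarrow> cyclic_clique n r A"
  unfolding cyclic_clique_def by blast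

lemma cyclic_clique_mono: "cyclic_clique n r A \<Longrightarrow> r \<le> s \<Longrightarrow> cyclic_clique n s A"
  unfolding cyclic_clique_def by force

lemma block_startI:
  assumes "x mod n \<in> A"
    and "\<And>a. a mod n \<in> A \<Longrightarrow> x - r \<le> a \<Longrightarrow> a < x \<Longrightarrow>
           \<exists>b. b mod n \<in> A \<and> x \<le> b \<and> b \<le> x + r \<and> a + r < b"
  shows "block_start n r A x"
  using assms by (auto simp: block_start_def)

lemma block_startE:
  assumes "block_start n r A x" "a mod n \<in> A" "x - r \<le> a" "a < x"
  obtains b where "b mod n \<in> A" "x \<le> b" "b \<le> x + r" "a + r < b"
  using assms by (auto simp: block_start_def)

lemma block_start_in: "block_start n r A x \<Longrightarrow> x mod n \<in> A"
  by (auto simp: block_start_def)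

lemma block_start_add_period:
  assumes "block_start n r A x"
  shows "block_start n r A (x + k * n)"
proof (rule block_startI)
  show "(x + k * n) mod n \<in> A"
    using block_start_in[OF assms] by simp
next
  fix a assume a: "a mod n \<in> A" "x + k * n - r \<le> a" "a < x + k * n"
  have "(a - k * n) mod n \<in> A"
    using a(1) by (metis diff_add_cancel mod_mult_self1)
  with assms a obtain b where "b mod n \<in> A" "x \<le> b" "b \<le> x + r" "a - k * n + r < b"
    by (elim block_startE[where a = "a - k * n"]) auto
  then show "\<exists>b. b mod n \<in> A \<and> x + k * n \<le> b \<and> b \<le> x + k * n + r \<and> a + r < b"
    by (intro exI[of _ "b + k * n"]) auto
qed

lemma block_start_mod: "block_start n r A (x mod n) \<longleftrightarrow> block_start n r A x"
proof -
  have "x mod n + (x div n) * n = x" "x + (- (x div n)) * n = x mod n"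
    by (simp_all add: minus_div_mult_eq_mod)
  then show ?thesis
    using block_start_add_period[of n r A "x mod n" "x div n"]
      block_start_add_period[of n r A x "- (x div n)"] by metis
qed

text \<open>The point \<open>x\<close> is within reach of \<open>x - r\<close> but beyond the reach
  of every earlier \<open>a\<close>, so it is the witness \<open>b\<close> against all of
  them.\<close>

lemma block_start_backwards:
  assumes "x mod n \<in> A" "(x - r) mod n \<in> A"
  shows "block_start n r A (x - r)"
  using assms by (intro block_startI) (auto intro!: exI[of _ x])

text \<open>No two points of the clique differ by exactly \<open>r + 1\<close>, since
  \<open>r + 1 < n - r\<close>. Hence \<open>y\<close> begins no block, and \<open>y - 1\<close> can
  stand in for \<open>y\<close> both as the earlier point \<open>a\<close> and as the witness
  \<open>b\<close>.\<close>

lemma block_start_insert: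
  assumes r: "1 \<le> r" "2 * r + 2 \<le> n"
    and clique: "cyclic_clique n r (insert y A)"
    and y: "0 \<le> y" "y < n" "y \<notin> A" "(y - 1) mod n \<in> A"
  shows "block_start n r (insert y A) z \<longleftrightarrow> block_start n r A z"
proof -
  let ?B = "insert y A"
  have pred: "(b - 1) mod n \<in> A" if "b mod n = y" for b
    using y(4) that by (metis mod_diff_left_eq)
  show ?thesis
  proof
    assume z: "block_start n r ?B z"
    have "z mod n \<noteq> y"
    proof
      assume zy: "z mod n = y"
      have "(z - 1) mod n \<in> ?B" using pred[OF zy] by simp
      from block_startE[OF z this] obtain b where b: "b mod n \<in> ?B" "z \<le> b" "b \<le> z + r" "z - 1 + r < b"
        using r by auto
      then have "b = z + r" by simp
      with b(1) cyclic_cliqueD[OF clique \<open>(z - 1) mod n \<in> ?B\<close>] r show False by force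
    qed
    with block_start_in[OF z] have zA: "z mod n \<in> A" by simp
    then show "block_start n r A z"
    proof (rule block_startI)
      fix a assume a: "a mod n \<in> A" "z - r \<le> a" "a < z"
      then obtain b where b: "b mod n \<in> ?B" "z \<le> b" "b \<le> z + r" "a + r < b"
        using block_startE[OF z, of a] by blast
      show "\<exists>b. b mod n \<in> A \<and> z \<le> b \<and> b \<le> z + r \<and> a + r < b"
      proof (cases "b mod n \<in> A")
        case False
        with b have beq: "b mod n = y" by simp
        have "z \<noteq> b" using beq zA y(3) by auto
        moreover have "b \<noteq> a + r + 1"
          using cyclic_cliqueD[OF clique, of a b] a(1) b(1) r by auto
        ultimately show ?thesis
          using pred[OF beq] b by (intro exI[of _ "b - 1"]) auto
      qed (use b in blast)
    qed
  next
    assume z: "block_start n r A z"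
    then have zA: "z mod n \<in> A" by (rule block_start_in)
    show "block_start n r ?B z"
    proof (rule block_startI)
      show "z mod n \<in> ?B" using zA by simp
      fix a assume a: "a mod n \<in> ?B" "z - r \<le> a" "a < z"
      show "\<exists>b. b mod n \<in> ?B \<and> z \<le> b \<and> b \<le> z + r \<and> a + r < b"
      proof (cases "a mod n \<in> A")
        case True
        with z a block_startE[OF z, of a] show ?thesis by blast
      next
        case False
        with a have ay: "a mod n = y" by simp
        note a' = pred[OF ay]
        have "a \<noteq> z - r"
          using cyclic_cliqueD[OF clique, of "a - 1" z] a' zA r by auto
        then obtain b where b: "b mod n \<in> A" "z \<le> b" "b \<le> z + r" "a - 1 + r < b"
          using block_startE[OF z, of "a - 1"] a a' by auto
        have "b \<noteq> a + r"
          using cyclic_cliqueD[OF clique, of "a - 1" b] a' b(1) r by auto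
        with b show ?thesis by (intro exI[of _ b]) auto
      qed
    qed
  qed
qed

text \<open>Only the condition at \<open>x - r\<close> could change, namely if \<open>x - r\<close>
  is the new point \<open>y\<close>. But then \<open>block_start_backwards\<close> makes
  \<open>y\<close> a block start of the larger clique, hence an element of \<open>A\<close>.\<close>

lemma free_starts_insert:
  assumes r: "1 \<le> r" "2 * r + 2 \<le> n"
    and clique: "cyclic_clique n r (insert y A)"
    and y: "0 \<le> y" "y < n" "y \<notin> A" "(y - 1) mod n \<in> A"
  shows "free_starts n r (insert y A) = free_starts n r A"
proof -
  note bs = block_start_insert[OF assms]
  have "(x - r) mod n \<noteq> y" if x: "block_start n r A x" for x
  proof
    assume eq: "(x - r) mod n = y"
    have "block_start n r (insert y A) (x - r)"
      using block_start_backwards[of x n "insert y A" r] block_start_in[OF x] eq by auto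
    then have "(x - r) mod n \<in> A" using bs block_start_in by blast
    with eq y show False by simp
  qed
  then show ?thesis unfolding free_starts_def using bs by auto
qed

text \<open>A forward difference from \<open>x + 1\<close> is one less than from \<open>x\<close>,
  so a new violation forces the difference from \<open>x\<close> to be exactly \<open>n - r\<close>:
  it involves the excluded point \<open>x - r\<close>.\<close>

lemma cyclic_clique_insert_succ:
  assumes clique: "cyclic_clique n r A" and n: "2 * r + 2 \<le> n" "0 \<le> r"
    and x: "x mod n \<in> A" "(x - r) mod n \<notin> A"
  shows "cyclic_clique n r (insert ((x + 1) mod n) A)"
proof -
  have key: False
    if "w mod n = (x + 1) mod n" "v mod n \<in> A" "r < v - w" "v - w < n - r" for v w
  proof -
    have xw: "(w - 1) mod n = x mod n"
      using that(1) by (metis add_diff_cancel_right' mod_diff_left_eq)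
    have "v - w = n - r - 1"
      using cyclic_cliqueD[OF clique, of "w - 1" v] xw x(1) that by force
    then have "v = (w - 1 - r) + n" by simp
    then have "v mod n = (w - 1 - r) mod n" by simp
    also have "\<dots> = (x - r) mod n"
      using xw by (metis mod_diff_left_eq)
    finally show False using that x by simp
  qed
  have key': False
    if "w mod n = (x + 1) mod n" "v mod n \<in> A" "r < w - v" "w - v < n - r" for v w
    using key[of w "v + n"] that by simp
  have "\<not> (r < v - u \<and> v - u < n - r)" if "u mod n = (x + 1) mod n" "v mod n = (x + 1) mod n" for u v
  proof
    assume *: "r < v - u \<and> v - u < n - r"
    have "n dvd v - u" using that by (metis mod_eq_dvd_iff)
    with * n show False by (auto dest: zdvd_imp_le)
  qed
  with key key' clique show ?thesis
    unfolding cyclic_clique_def by blast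
qed

section \<open>The sign-reversing involution\<close>

text \<open>The toggled point is determined by \<open>free_starts\<close> alone, which toggling
  preserves; this makes the map an involution.\<close>

definition toggle :: "int \<Rightarrow> int \<Rightarrow> int set \<Rightarrow> int set" where
  "toggle n r A = (let y = (Min (free_starts n r A) + 1) mod n
     in if y \<in> A then A - {y} else insert y A)"

lemma toggle_properties:
  assumes r: "0 \<le> r" "2 * r + 2 \<le> n"
    and A: "cyclic_clique n r A" "A \<subseteq> {0..<n}" "free_starts n r A \<noteq> {}"
  shows "cyclic_clique n r (toggle n r A)" "toggle n r A \<subseteq> {0..<n}"
    "free_starts n r (toggle n r A) = free_starts n r A" "toggle n r A \<noteq> {}"
    "toggle n r (toggle n r A) = A"
    "(- 1) ^ (card (toggle n r A) - 1) = - ((- 1) ^ (card A - 1) :: real)"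
proof -
  define x where "x = Min (free_starts n r A)"
  define y where "y = (x + 1) mod n"
  have tog: "toggle n r A = (if y \<in> A then A - {y} else insert y A)"
    by (simp add: toggle_def x_def y_def Let_def)
  have "finite (free_starts n r A)"
    by (rule finite_subset[of _ "{0..<n}"]) (auto simp: free_starts_def)
  then have "x \<in> free_starts n r A" using A(3) unfolding x_def by (rule Min_in)
  then have x: "0 \<le> x" "x < n" "x \<in> A" "(x - r) mod n \<notin> A"
    using block_start_in[of n r A x] by (auto simp: free_starts_def)
  \<comment> \<open>With \<open>r = 0\<close> the point \<open>x - r\<close> would be
    \<open>x\<close>, which lies in \<open>A\<close>.\<close>
  have r1: "1 \<le> r" using x r by (cases "r = 0") auto
  have y: "0 \<le> y" "y < n" using r by (auto simp: y_def)
  have yx: "(y - 1) mod n = x" using x by (simp add: y_def mod_diff_left_eq)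
  have xy: "x \<noteq> y"
  proof (cases "x + 1 = n")
    case False
    with x show ?thesis by (simp add: y_def)
  qed (use r x in \<open>auto simp: y_def\<close>)
  have finA: "finite A" using A(2) finite_subset by blast
  have ins: "cyclic_clique n r (insert y A)"
    unfolding y_def using A x r by (intro cyclic_clique_insert_succ) auto
  show clq: "cyclic_clique n r (toggle n r A)"
    using ins A(1) by (auto simp: tog intro: cyclic_clique_subset)
  show "toggle n r A \<subseteq> {0..<n}" using A y by (auto simp: tog)
  show fs: "free_starts n r (toggle n r A) = free_starts n r A"
  proof (cases "y \<in> A")
    case True
    then show ?thesis
      using free_starts_insert[OF r1 r(2), of y "A - {y}"] A(1) y yx x xy
      by (simp add: tog insert_absorb)
  next
    case False
    then show ?thesis
      using free_starts_insert[OF r1 r(2) ins] y yx x by (simp add: tog)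
  qed
  show "toggle n r A \<noteq> {}" using x xy by (auto simp: tog)
  have "toggle n r (toggle n r A) =
      (if y \<in> toggle n r A then toggle n r A - {y} else insert y (toggle n r A))"
    unfolding toggle_def[of n r "toggle n r A"] fs by (simp add: x_def y_def Let_def)
  then show "toggle n r (toggle n r A) = A" by (auto simp: tog)
  have "card A > 0" using finA x by (auto simp: card_gt_0_iff)
  \<comment> \<open>Subtraction in the exponents is truncated: when \<open>y\<close> is deleted the
    point \<open>x\<close> remains, so no exponent is cut off at \<open>0\<close>.\<close>
  moreover have "card A - 1 > 0" if "y \<in> A"
  proof -
    have "card {x, y} \<le> card A" using that x finA by (intro card_mono) auto
    with xy show ?thesis by simp
  qed
  ultimately show "(- 1) ^ (card (toggle n r A) - 1) = - ((- 1) ^ (card A - 1) :: real)"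
    using finA by (auto simp: tog card_Diff_singleton power_eq_if)
qed

section \<open>Cliques without free starts\<close>

text \<open>Among the points of \<open>A\<close> in \<open>{x - r..x}\<close> that see everything
  \<open>x\<close> sees ahead, the least one begins a block: an earlier point seeing all that it
  sees would qualify too.\<close>

lemma ex_block_start:
  assumes "x mod n \<in> A" "0 \<le> r"
  shows "\<exists>a. block_start n r A a"
proof -
  define C where "C = {a \<in> {x - r..x}. a mod n \<in> A \<and> (\<forall>b. b mod n \<in> A \<longrightarrow> x \<le> b \<longrightarrow> b \<le> x + r \<longrightarrow> b \<le> a + r)}"
  define a where "a = Min C"
  have "finite C" by (rule finite_subset[of _ "{x - r..x}"]) (auto simp: C_def)
  moreover have "x \<in> C" using assms by (simp add: C_def)
  ultimately have aC: "a \<in> C" and least: "\<And>c. c \<in> C \<Longrightarrow> a \<le> c"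
    unfolding a_def by (auto intro: Min_in)
  have "block_start n r A a"
  proof (rule block_startI)
    show "a mod n \<in> A" using aC by (simp add: C_def)
    fix c assume c: "c mod n \<in> A" "a - r \<le> c" "c < a"
    show "\<exists>b. b mod n \<in> A \<and> a \<le> b \<and> b \<le> a + r \<and> c + r < b"
    proof (rule ccontr)
      assume contr: "\<not> ?thesis"
      have "x \<le> c + r" using contr aC assms by (force simp: C_def)
      moreover have "b \<le> c + r" if "b mod n \<in> A" "x \<le> b" "b \<le> x + r" for b
        using contr aC that by (force simp: C_def)
      ultimately have "c \<in> C" using c aC by (auto simp: C_def)
      with least c show False by force
    qed
  qed
  then show ?thesis ..
qed

text \<open>Without free starts, \<open>w - r\<close> lies in the clique for every block start
  \<open>w\<close> and is again a block start. So the clique contains a full orbit of the shift by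
  \<open>r\<close>, a residue class modulo \<open>d = gcd r n\<close>. Differences strictly between
  \<open>r\<close> and \<open>n - r = r + m\<close> are forbidden, which forces \<open>d = m\<close>
  and excludes every further point.\<close>

lemma no_free_starts_imp_residue_class:
  assumes r: "0 \<le> r" "2 * r < n"
    and A: "cyclic_clique n r A" "A \<subseteq> {0..<n}" "A \<noteq> {}" "free_starts n r A = {}"
  shows "n - 2 * r dvd r \<and> (\<exists>c \<in> {0..<n - 2 * r}. A = {z \<in> {0..<n}. z mod (n - 2 * r) = c})"
proof -
  define m where "m = n - 2 * r"
  have m: "0 < m" using r by (simp add: m_def)
  obtain x0 where "x0 \<in> A" using A by blast
  then have "x0 mod n \<in> A" using A by auto
  then obtain x where x: "block_start n r A x" using ex_block_start r by blast
  have step: "block_start n r A (w - r)" if w: "block_start n r A w" for w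
  proof (rule block_start_backwards)
    show "w mod n \<in> A" using w by (rule block_start_in)
    have "block_start n r A (w mod n)" "w mod n \<in> {0..<n}"
      using w r by (simp_all add: block_start_mod)
    then have "(w mod n - r) mod n \<in> A"
      using A(4) unfolding free_starts_def by blast
    then show "(w - r) mod n \<in> A" by (simp add: mod_diff_left_eq)
  qed
  have down: "block_start n r A (x - int k * r)" for k
  proof (induction k)
    case (Suc k)
    from step[OF this] show ?case by (simp add: algebra_simps)
  qed (use x in simp)
  have inA: "(x + i * r + j * n) mod n \<in> A" for i j
  proof -
    \<comment> \<open>Only nonnegative multiples of \<open>- r\<close> are available so far;
      \<open>k\<close> is a nonnegative number congruent to \<open>- i\<close> modulo
      \<open>n\<close>.\<close>
    define k where "k = nat (\<bar>i\<bar> * n - i)"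
    have "1 * \<bar>i\<bar> \<le> n * \<bar>i\<bar>" using r by (intro mult_right_mono) auto
    then have "int k = \<bar>i\<bar> * n - i" by (simp add: k_def mult.commute)
    then have "x - int k * r = x + i * r + (- \<bar>i\<bar> * r) * n"
      by (simp only:) (simp add: algebra_simps)
    then have "(x - int k * r) mod n = (x + i * r) mod n" by (metis mod_mult_self1)
    then show ?thesis using block_start_in[OF down[of k]] by simp
  qed
  define d where "d = gcd r n"
  have d: "d > 0" using r by (simp add: d_def)
  obtain i j where ij: "i * r + j * n = d"
    using bezout_int[of r n] unfolding d_def by blast
  have inA_d: "(x + k * d) mod n \<in> A" for k
    using inA[of "k * i" "k * j"] unfolding ij[symmetric] by (simp add: algebra_simps)
  have dm: "d dvd m" unfolding m_def d_def by (intro dvd_diff) auto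
  then have "d \<le> m" using m by (simp add: zdvd_imp_le)
  moreover have "\<not> d < m"
  proof
    assume "d < m"
    obtain q where q: "r = q * d" unfolding d_def by (metis dvd_def gcd_dvd1 mult.commute)
    have "(x + (q + 1) * d) - (x + 0 * d) = r + d" by (simp add: q algebra_simps)
    then show False
      using cyclic_cliqueD[OF A(1) inA_d[of 0] inA_d[of "q + 1"]] \<open>d < m\<close> d
      unfolding m_def by linarith
  qed
  ultimately have dm: "d = m" by simp
  have mr: "m dvd r" "m dvd n" using dm unfolding d_def by (metis gcd_dvd1, metis gcd_dvd2)
  have "A = {z \<in> {0..<n}. z mod m = x mod m}"
  proof (intro equalityI subsetI)
    fix z assume z: "z \<in> A"
    then have zn: "z \<in> {0..<n}" "z mod n \<in> A" using A(2) by auto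
    define e where "e = (z - x) mod m"
    have e: "0 \<le> e" "e < m" using m by (auto simp: e_def)
    obtain q where q: "r = m * q" using mr by blast
    have "z = x + ((z - x) div m) * m + e" by (simp add: e_def)
    \<comment> \<open>Going back by a further \<open>r\<close>, a multiple of \<open>m\<close>,
      gives a point of the class at difference \<open>r + e\<close> from \<open>z\<close>, forbidden
      unless \<open>e = 0\<close>.\<close>
    then have "z - (x + ((z - x) div m - q) * d) = e + r"
      unfolding q dm by (simp add: algebra_simps)
    then have "e = 0"
      using cyclic_cliqueD[OF A(1) inA_d[of "(z - x) div m - q"] zn(2)] e m_def by force
    then show "z \<in> {z \<in> {0..<n}. z mod m = x mod m}"
      using zn by (simp add: e_def mod_eq_dvd_iff dvd_eq_mod_eq_0)
  next
    fix z assume z: "z \<in> {z \<in> {0..<n}. z mod m = x mod m}"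
    then have "m dvd z - x" by (simp add: mod_eq_dvd_iff)
    then obtain k where "z = x + k * d" unfolding dm by (metis add.commute diff_add_cancel dvd_def mult.commute)
    then show "z \<in> A" using inA_d[of k] z by auto
  qed
  moreover have "x mod m \<in> {0..<m}" using m by simp
  ultimately show ?thesis using mr unfolding m_def by blast
qed

text \<open>For \<open>m = n - 2 * r\<close> and \<open>r = m * q\<close> one has
  \<open>n = (2 * q + 1) * m\<close>, and no multiple of \<open>m\<close> lies strictly between
  \<open>r = m * q\<close> and \<open>n - r = m * (q + 1)\<close>. Shifting by \<open>r\<close>
  stays in the class, so no start is free, and the class has \<open>2 * q + 1\<close>
  points.\<close>

lemma residue_class_no_free_starts:
  assumes r: "0 \<le> r" "2 * r < n" and m: "n - 2 * r dvd r" and c: "0 \<le> c" "c < n - 2 * r"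
  defines "A \<equiv> {z \<in> {0..<n}. z mod (n - 2 * r) = c}"
  shows "cyclic_clique n r A" "free_starts n r A = {}" "A \<noteq> {}" "odd (card A)"
proof -
  define m where "m = n - 2 * r"
  have mpos: "0 < m" using r by (simp add: m_def)
  obtain q where q: "r = m * q" using assms m_def by blast
  have n: "n = (2 * q + 1) * m" using q by (simp add: m_def algebra_simps)
  have q0: "0 \<le> q" using q r mpos by (metis linorder_not_le mult_pos_neg)
  have inA: "z mod n \<in> A \<longleftrightarrow> z mod m = c" for z
  proof -
    have "m dvd n" by (simp add: n)
    then show ?thesis using r by (simp add: A_def m_def[symmetric] mod_mod_cancel)
  qed
  show "cyclic_clique n r A" unfolding cyclic_clique_def inA
  proof (intro allI impI notI)
    fix u v assume uv: "u mod m = c" "v mod m = c" "r < v - u \<and> v - u < n - r"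
    then have "m dvd v - u" by (metis mod_eq_dvd_iff)
    then obtain k where "v - u = m * k" by blast
    with uv(3) n q have "m * q < m * k" "m * k < m * (q + 1)" by (auto simp: algebra_simps)
    with mpos show False by simp
  qed
  have "(x - r) mod m = x mod m" for x by (simp add: q mod_eq_dvd_iff)
  then show "free_starts n r A = {}"
    using inA block_start_in[of n r A] by (auto simp: free_starts_def)
  have "c \<in> A" using c r q0 mpos by (auto simp: A_def m_def[symmetric] n algebra_simps)
  then show "A \<noteq> {}" by blast
  have "bij_betw (\<lambda>k. c + k * m) {0..2 * q} A"
  proof (rule bij_betwI[where g = "\<lambda>z. z div m"])
    show "(\<lambda>k. c + k * m) \<in> {0..2 * q} \<rightarrow> A"
    proof
      fix k assume k: "k \<in> {0..2 * q}"
      then have "k * m \<le> 2 * q * m" "0 \<le> k * m" using mpos by (auto intro: mult_right_mono)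
      moreover have cm: "c < m" using c by (simp add: m_def)
      ultimately have "c + k * m < n" "0 \<le> c + k * m"
        using c unfolding n distrib_right by linarith+
      moreover have "(c + k * m) mod m = c" using c(1) cm by simp
      ultimately show "c + k * m \<in> A" by (simp add: A_def m_def[symmetric])
    qed
    show "(\<lambda>z. z div m) \<in> A \<rightarrow> {0..2 * q}"
    proof
      fix z assume z: "z \<in> A"
      then have "z < (2 * q + 1) * m" by (simp add: A_def n)
      moreover have "(z div m) * m \<le> z" using mpos by (simp add: minus_mod_eq_div_mult[symmetric])
      ultimately have "(z div m) * m < (2 * q + 1) * m" by linarith
      then have "z div m < 2 * q + 1" using mpos by (simp only: mult_less_cancel_right)
      moreover have "0 \<le> z div m" using z mpos by (simp add: A_def pos_imp_zdiv_nonneg_iff)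
      ultimately show "z div m \<in> {0..2 * q}" by simp
    qed
    show "(c + k * m) div m = k" for k using c mpos by (simp add: m_def[symmetric])
    show "c + (z div m) * m = z" if "z \<in> A" for z
      using that by (auto simp: A_def m_def[symmetric])
  qed
  then have "card A = card {0..2 * q}" by (simp only: bij_betw_same_card)
  also have "\<dots> = Suc (2 * nat q)" using q0 by (simp add: nat_add_distrib nat_mult_distrib)
  finally show "odd (card A)" by simp
qed

text \<open>The toggle cancels all cliques with a free start. What remains is nothing or the
  \<open>n - 2 * r\<close> residue classes, each of odd cardinality and hence of sign
  \<open>1\<close>.\<close>

lemma sum_cyclic_cliques:
  assumes r: "0 \<le> r" "2 * r + 2 \<le> n"
  shows "(\<Sum>A | A \<noteq> {} \<and> A \<subseteq> {0..<n} \<and> cyclic_clique n r A. (- 1) ^ (card A - 1)) =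
    (if n - 2 * r dvd r then real_of_int (n - 2 * r) else 0)"
proof -
  define m where "m = n - 2 * r"
  let ?g = "\<lambda>A :: int set. (- 1) ^ (card A - 1) :: real"
  define K where "K = {A. A \<noteq> {} \<and> A \<subseteq> {0..<n} \<and> cyclic_clique n r A}"
  define M where "M = {A \<in> K. free_starts n r A \<noteq> {}}"
  define S where "S = {A \<in> K. free_starts n r A = {}}"
  have finK: "finite K" by (rule finite_subset[of _ "Pow {0..<n}"]) (auto simp: K_def)
  have "sum ?g M = (\<Sum>A\<in>M. - ?g A)"
    by (rule sum.reindex_bij_witness[of _ "toggle n r" "toggle n r"])
       (use toggle_properties[OF r] in \<open>auto simp: M_def K_def\<close>)
  then have M0: "sum ?g M = 0" by (simp add: sum_negf)
  have cls: "S = (if m dvd r then (\<lambda>c. {z \<in> {0..<n}. z mod m = c}) ` {0..<m} else {})"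
  proof -
    have "S \<subseteq> (\<lambda>c. {z \<in> {0..<n}. z mod m = c}) ` {0..<m}" "S \<noteq> {} \<Longrightarrow> m dvd r"
      using no_free_starts_imp_residue_class[of r n] r by (auto simp: S_def K_def m_def)
    moreover have "{z \<in> {0..<n}. z mod m = c} \<in> S" if "m dvd r" "c \<in> {0..<m}" for c
      using residue_class_no_free_starts(1-3)[of r n c] that r unfolding S_def K_def m_def by auto
    moreover have "(\<lambda>c. {z \<in> {0..<n}. z mod m = c}) ` {0..<m} \<subseteq> S" if "m dvd r"
      using that calculation(3) by blast
    ultimately show ?thesis by auto
  qed
  have odd: "?g A = 1" if A: "A \<in> S" for A
  proof -
    have "m dvd r" using A cls by (auto split: if_splits)
    with A cls obtain c where "c \<in> {0..<m}" "A = {z \<in> {0..<n}. z mod m = c}" by auto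
    then have "odd (card A)"
      using residue_class_no_free_starts(4)[of r n c] \<open>m dvd r\<close> r by (simp add: m_def)
    then show ?thesis by (auto elim: oddE)
  qed
  have "card S = (if m dvd r then nat m else 0)"
  proof (cases "m dvd r")
    case True
    have "inj_on (\<lambda>c. {z \<in> {0..<n}. z mod m = c}) {0..<m}"
    proof (rule inj_onI)
      fix c d assume c: "c \<in> {0..<m}" and d: "d \<in> {0..<m}"
        and eq: "{z \<in> {0..<n}. z mod m = c} = {z \<in> {0..<n}. z mod m = d}"
      have "c \<in> {z \<in> {0..<n}. z mod m = c}" using c r by (auto simp: m_def)
      then have "c \<in> {z \<in> {0..<n}. z mod m = d}" unfolding eq .
      moreover have "c mod m = c" using c by simp
      ultimately show "c = d" by (simp only: mem_Collect_eq)
    qed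
    then show ?thesis using True cls by (simp add: card_image)
  qed (use cls in simp)
  moreover have "sum ?g S = real (card S)" using odd by simp
  moreover have "sum ?g K = sum ?g M + sum ?g S"
    using finK by (subst sum.union_disjoint[symmetric]) (auto simp: M_def S_def intro!: sum.cong)
  ultimately show ?thesis using M0 r unfolding K_def m_def by simp
qed


section \<open>Rips magnitude of the Euclidean cycles\<close>

definition cycle_point :: "int \<Rightarrow> int \<Rightarrow> real ^ 2" where
  "cycle_point n z = vector [cos (2 * pi * z / n), sin (2 * pi * z / n)]"

lemma dist_cycle_point:
  assumes "n > 0"
  shows "dist (cycle_point n u) (cycle_point n v) = 2 * \<bar>sin (pi * of_int (v - u) / n)\<bar>"
proof -
  define a b where "a = pi * u / n" and "b = pi * v / n"
  have "(dist (cycle_point n u) (cycle_point n v))\<^sup>2 =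
      (cos (2 * a) - cos (2 * b))\<^sup>2 + (sin (2 * a) - sin (2 * b))\<^sup>2"
    by (simp add: dist_vec_def L2_set_def sum_2 cycle_point_def dist_real_def a_def b_def
        mult.assoc)
  also have "\<dots> = ((sin (2 * a))\<^sup>2 + (cos (2 * a))\<^sup>2) + ((sin (2 * b))\<^sup>2 + (cos (2 * b))\<^sup>2)
      - 2 * (cos (2 * b) * cos (2 * a) + sin (2 * b) * sin (2 * a))"
    by (simp add: power2_eq_square algebra_simps)
  also have "\<dots> = 2 - 2 * cos (2 * (b - a))"
    by (simp only: right_diff_distrib cos_diff sin_cos_squared_add)
  also have "\<dots> = (2 * \<bar>sin (b - a)\<bar>)\<^sup>2"
    by (simp only: cos_double_sin power_mult_distrib power2_abs) simp
  finally have "dist (cycle_point n u) (cycle_point n v) = 2 * \<bar>sin (b - a)\<bar>"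
    by (rule power2_eq_imp_eq) auto
  then show ?thesis by (simp add: a_def b_def diff_divide_distrib right_diff_distrib)
qed

lemma cycle_point_mod:
  assumes "n > 0"
  shows "cycle_point n (z mod n) = cycle_point n z"
proof -
  have "of_int (z - z mod n) = real_of_int n * real_of_int (z div n)"
    by (metis minus_mod_eq_mult_div of_int_mult)
  then have "pi * of_int (z - z mod n) / n = of_int (z div n) * pi" using assms by simp
  then have "dist (cycle_point n (z mod n)) (cycle_point n z) = 0"
    using assms by (simp only: dist_cycle_point) (simp add: sin_integer_2pi sin_zero_iff_int2)
  then show ?thesis by simp
qed

lemma sin_frac_mono:
  fixes n w s :: int
  assumes "0 < n" "0 \<le> w" "w \<le> s" "2 * s \<le> n"
  shows "sin (pi * w / n) \<le> sin (pi * s / n)" "0 \<le> sin (pi * w / n)"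
proof -
  have mono: "sin a \<le> sin b \<and> 0 \<le> sin a" if "0 \<le> a" "a \<le> b" "b \<le> pi / 2" for a b :: real
    using that pi_gt_zero by (auto intro!: sin_monotone_2pi_le sin_ge_zero)
  have "real_of_int (2 * s) \<le> n" using assms by linarith
  then have "pi * s / n \<le> pi / 2"
    using assms mult_left_mono[of "2 * real_of_int s" n pi] by (simp add: field_simps)
  moreover have "pi * w / n \<le> pi * s / n" "0 \<le> pi * w / n"
    using assms by (auto intro!: divide_right_mono)
  ultimately show "sin (pi * w / n) \<le> sin (pi * s / n)" "0 \<le> sin (pi * w / n)"
    using mono by blast+
qed

lemma sin_frac_reflect:
  fixes n w :: int
  assumes "0 < n"
  shows "sin (pi * of_int (n - w) / n) = sin (pi * w / n)"
proof -
  have "pi * of_int (n - w) / n = pi - pi * w / n" using assms by (simp add: field_simps)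
  then show ?thesis by simp
qed

lemma cyclic_clique_half: "n \<le> 2 * r + 1 \<Longrightarrow> cyclic_clique n r A"
  by (auto simp: cyclic_clique_def)

text \<open>The integer scale at which \<open>A\<close> enters the filtration. The minimum exists
  because \<open>n div 2\<close> always qualifies: the forbidden range then contains no
  integer.\<close>

definition clique_scale :: "nat \<Rightarrow> int set \<Rightarrow> nat" where
  "clique_scale n A = (LEAST r. cyclic_clique (int n) (int r) A)"

lemma cyclic_clique_div2: "cyclic_clique (int n) (int (n div 2)) A"
  by (rule cyclic_clique_half) presburger

lemma clique_scale_le_iff: "clique_scale n A \<le> r \<longleftrightarrow> cyclic_clique (int n) (int r) A"
proof
  assume "clique_scale n A \<le> r"
  moreover have "cyclic_clique (int n) (int (clique_scale n A)) A"
    unfolding clique_scale_def by (rule LeastI[where P = "\<lambda>r. cyclic_clique (int n) (int r) A",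
          OF cyclic_clique_div2])
  ultimately show "cyclic_clique (int n) (int r) A"
    by (auto intro: cyclic_clique_mono)
qed (auto simp: clique_scale_def intro: Least_le)

text \<open>The sine increases up to half the circle. Being a clique at scale \<open>d\<close>
  bounds all chords by the one of step \<open>d\<close>; failing to be one at scale
  \<open>d - 1\<close> yields a pair at circular distance at least \<open>d\<close>.\<close>

lemma diameter_cycle_points:
  assumes A: "A \<subseteq> {0..<int n}" "A \<noteq> {}"
  shows "diameter (cycle_point (int n) ` A) = 2 * sin (pi * clique_scale n A / n)"
proof -
  define d where "d = clique_scale n A"
  have n: "0 < int n" using A by auto
  have clq: "cyclic_clique (int n) (int d) A"
    using clique_scale_le_iff[of n A d] by (simp add: d_def)
  have "d \<le> n div 2" unfolding d_def clique_scale_le_iff by (rule cyclic_clique_div2)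
  then have dn: "2 * int d \<le> int n" by linarith
  note dist = dist_cycle_point[OF n]
  have upper: "dist (cycle_point n u) (cycle_point n v) \<le> 2 * sin (pi * d / n)"
    if uv: "u \<in> A" "v \<in> A" "u \<le> v" for u v
  proof -
    define w where "w = v - u"
    have "u \<in> {0..<int n}" "v \<in> {0..<int n}" using uv A by blast+
    with uv have w: "0 \<le> w" "w < int n" by (auto simp: w_def)
    have "w \<le> d \<or> int n - d \<le> w"
      using cyclic_cliqueD[OF clq, of u v] uv A unfolding w_def by fastforce
    then have "0 \<le> sin (pi * w / int n) \<and> sin (pi * w / int n) \<le> sin (pi * int d / int n)"
    proof
      assume "w \<le> d"
      then show ?thesis using sin_frac_mono[of n w d] n w dn by simp
    next
      assume "int n - d \<le> w"
      then show ?thesis using sin_frac_mono[of n "int n - w" d] n w dn sin_frac_reflect[of n w]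
        by simp
    qed
    then show ?thesis unfolding dist by (simp add: w_def)
  qed
  have "diameter (cycle_point n ` A) \<le> 2 * sin (pi * d / n)"
  proof (rule diameter_le)
    fix x y assume "x \<in> cycle_point n ` A" "y \<in> cycle_point n ` A"
    then obtain u v where uv: "u \<in> A" "v \<in> A" "x = cycle_point n u" "y = cycle_point n v" by auto
    then show "norm (x - y) \<le> 2 * sin (pi * d / n)"
      using upper[of u v] upper[of v u] by (cases "u \<le> v") (auto simp: dist_norm norm_minus_commute)
  qed (use A in auto)
  moreover have "2 * sin (pi * d / n) \<le> diameter (cycle_point n ` A)"
  proof (cases "d = 0")
    case True
    then show ?thesis
      by (simp add: diameter_ge_0 finite_imp_bounded finite_subset[OF A(1)])
  next
    case False
    then have "\<not> cyclic_clique (int n) (int (d - 1)) A"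
      unfolding clique_scale_le_iff[symmetric] d_def by simp
    then obtain u v where uv: "u mod int n \<in> A" "v mod int n \<in> A"
        "int d \<le> v - u" "v - u \<le> int n - d"
      using False by (auto simp: cyclic_clique_def of_nat_diff)
    define w where "w = v - u"
    have "sin (pi * int d / int n) \<le> sin (pi * w / int n)"
    proof (cases "2 * w \<le> int n")
      case True
      then show ?thesis using sin_frac_mono[of n d w] n uv by (simp add: w_def)
    next
      case False
      then show ?thesis
        using sin_frac_mono[of n d "int n - w"] n uv sin_frac_reflect[of n w] by (simp add: w_def)
    qed
    then have "2 * sin (pi * d / n) \<le> dist (cycle_point n u) (cycle_point n v)"
      unfolding dist by (simp add: w_def)
    also have "\<dots> = dist (cycle_point n (u mod n)) (cycle_point n (v mod n))"
      using n by (simp add: cycle_point_mod)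
    also have "\<dots> \<le> diameter (cycle_point n ` A)"
      using uv by (intro diameter_bounded_bound)
        (auto simp: finite_imp_bounded finite_subset[OF A(1)])
    finally show ?thesis .
  qed
  ultimately show ?thesis by (simp add: d_def)
qed

lemma inj_on_cycle_point: "inj_on (cycle_point (int n)) {0..<int n}"
proof (rule linorder_inj_onI)
  fix u v assume uv: "u < v" "u \<in> {0..<int n}" "v \<in> {0..<int n}"
  then have n: "0 < int n" by simp
  have "pi * of_int (v - u) / n < pi" using uv n
    by (simp add: pos_divide_less_eq)
  then have "0 < sin (pi * of_int (v - u) / int n)"
    using uv n by (intro sin_gt_zero) auto
  then have "dist (cycle_point n u) (cycle_point n v) \<noteq> 0"
    unfolding dist_cycle_point[OF n] by simp
  then show "cycle_point n u \<noteq> cycle_point n v" by auto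
qed auto

lemma euclidean_cycle_eq: "euclidean_cycle n = cycle_point (int n) ` {0..<int n}"
proof -
  have "{0..<int n} = int ` {..<n}"
    by (metis image_int_atLeastLessThan lessThan_atLeast0 of_nat_0)
  then show ?thesis by (simp add: euclidean_cycle_def cycle_point_def image_image)
qed

section \<open>Summation by parts and odd divisors\<close>

text \<open>The Euler characteristic of a full simplex: over all subsets the signs cancel by
  toggling \<open>x\<close>, and splitting off the empty set leaves \<open>1\<close>.\<close>

lemma sum_subsets_card_sign:
  assumes "finite X" "x \<in> X"
  shows "(\<Sum>A | A \<noteq> {} \<and> A \<subseteq> X. (- 1) ^ (card A - 1)) = (1 :: real)"
proof -
  define tog where "tog A = (if x \<in> A then A - {x} else insert x A)" for A
  have sgn: "(- 1) ^ card (tog A) = - ((- 1) ^ card A :: real)" if "A \<in> Pow X" for A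
  proof -
    have "finite A" using that assms finite_subset by auto
    show ?thesis
    proof (cases "x \<in> A")
      case True
      with \<open>finite A\<close> have "card A = Suc (card (A - {x}))" by (rule card.remove)
      then obtain c where "card (A - {x}) = c" "card A = Suc c" by blast
      with True show ?thesis by (simp add: tog_def)
    qed (use \<open>finite A\<close> in \<open>simp add: tog_def\<close>)
  qed
  have "(\<Sum>A\<in>Pow X. (- 1) ^ card A) = (\<Sum>A\<in>Pow X. - ((- 1) ^ card A :: real))"
  proof (rule sum.reindex_bij_witness[of _ tog tog])
    fix A assume A: "A \<in> Pow X"
    show "tog (tog A) = A" "tog (tog A) = A" by (auto simp: tog_def)
    show "tog A \<in> Pow X" "tog A \<in> Pow X" using A assms by (auto simp: tog_def)
    show "- ((- 1) ^ card (tog A)) = ((- 1) ^ card A :: real)" unfolding sgn[OF A] by simp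
  qed
  then have "(\<Sum>A\<in>Pow X. (- 1) ^ card A) = (0 :: real)" by (simp add: sum_negf)
  moreover have "(\<Sum>A\<in>Pow X. (- 1) ^ card A) =
      (\<Sum>A\<in>Pow X - {{}}. (- 1) ^ card A) + (1 :: real)"
    using assms by (simp add: sum.remove[of "Pow X" "{}"])
  moreover have "(\<Sum>A\<in>Pow X - {{}}. (- 1) ^ card A) =
      - (\<Sum>A\<in>Pow X - {{}}. (- 1) ^ (card A - 1) :: real)"
    unfolding sum_negf[symmetric]
  proof (rule sum.cong)
    fix A assume "A \<in> Pow X - {{}}"
    then have "card A > 0" using assms finite_subset by (auto simp: card_gt_0_iff)
    then obtain c where "card A = Suc c" by (auto simp: gr0_conv_Suc)
    then show "(- 1) ^ card A = - ((- 1) ^ (card A - 1) :: real)" by simp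
  qed simp
  moreover have "Pow X - {{}} = {A. A \<noteq> {} \<and> A \<subseteq> X}" by auto
  ultimately show ?thesis by simp
qed

text \<open>The weight \<open>f\<close> at the scale of \<open>A\<close> is
  \<open>f (n div 2)\<close> plus the differences \<open>f r - f (Suc r)\<close> from that scale on.
  Exchanging the sums turns the coefficient of each difference into the Euler characteristic of the
  clique complex at scale \<open>r\<close>.\<close>

lemma rips_magnitude_cycle_filtration:
  fixes t :: real
  assumes "n > 0"
  defines "f \<equiv> \<lambda>r::nat. exp (- 2 * t * sin (pi * r / n))"
  shows "rips_magnitude (euclidean_cycle n) t = f (n div 2) +
    (\<Sum>r | r < n div 2 \<and> n - 2 * r dvd r. real (n - 2 * r) * (f r - f (Suc r)))"
proof -
  let ?X = "{0..<int n}" and ?g = "\<lambda>A :: int set. (- 1) ^ (card A - 1) :: real"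
  define K where "K = {A. A \<noteq> {} \<and> A \<subseteq> ?X}"
  have finK: "finite K" by (rule finite_subset[of _ "Pow ?X"]) (auto simp: K_def)
  note inj = inj_on_cycle_point[of n]
  have "rips_magnitude (euclidean_cycle n) t = (\<Sum>A\<in>K. ?g A * f (clique_scale n A))"
    unfolding rips_magnitude_def
  proof (rule sum.reindex_cong[of "image (cycle_point (int n))"])
    show "inj_on ((`) (cycle_point (int n))) K"
      using inj_on_image_Pow[OF inj] by (rule inj_on_subset) (auto simp: K_def)
    show "{A. A \<noteq> {} \<and> A \<subseteq> euclidean_cycle n} = (`) (cycle_point (int n)) ` K"
      unfolding euclidean_cycle_eq K_def by (auto simp: subset_image_iff)
    fix A assume A: "A \<in> K"
    then have "card (cycle_point (int n) ` A) = card A"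
      by (intro card_image inj_on_subset[OF inj]) (auto simp: K_def)
    moreover have "diameter (cycle_point (int n) ` A) = 2 * sin (pi * clique_scale n A / n)"
      using A by (intro diameter_cycle_points) (auto simp: K_def)
    ultimately show "(- 1) ^ (card (cycle_point (int n) ` A) - 1) *
        exp (- diameter (cycle_point (int n) ` A) * t) = ?g A * f (clique_scale n A)"
      by (simp add: f_def mult_ac)
  qed
  also have "\<dots> = (\<Sum>A\<in>K. ?g A * f (n div 2) +
      (\<Sum>r<n div 2. if cyclic_clique n r A then ?g A * (f r - f (Suc r)) else 0))"
  proof (rule sum.cong)
    fix A
    define d where "d = clique_scale n A"
    have d: "d \<le> n div 2" unfolding d_def clique_scale_le_iff by (rule cyclic_clique_div2)
    have "(\<Sum>r<n div 2. if cyclic_clique n r A then f r - f (Suc r) else 0) =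
        (\<Sum>r | r < n div 2 \<and> d \<le> r. f r - f (Suc r))"
      by (simp add: sum.If_cases d_def clique_scale_le_iff Int_def)
    also have "{r. r < n div 2 \<and> d \<le> r} = {d..<n div 2}" by auto
    also have "(\<Sum>r = d..<n div 2. f r - f (Suc r)) = f d - f (n div 2)"
      using d sum_Suc_diff'[of d "n div 2" "\<lambda>r. - f r"] by simp
    finally have "?g A * f d = ?g A * (f (n div 2) +
        (\<Sum>r<n div 2. if cyclic_clique n r A then f r - f (Suc r) else 0))" by simp
    also have "\<dots> = ?g A * f (n div 2) +
      (\<Sum>r<n div 2. if cyclic_clique n r A then ?g A * (f r - f (Suc r)) else 0)"
      by (simp add: distrib_left sum_distrib_left if_distrib cong: if_cong)
    finally show "?g A * f (clique_scale n A) = ?g A * f (n div 2) +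
      (\<Sum>r<n div 2. if cyclic_clique n r A then ?g A * (f r - f (Suc r)) else 0)"
      by (simp add: d_def)
  qed simp
  also have "\<dots> = sum ?g K * f (n div 2) +
      (\<Sum>r<n div 2. \<Sum>A\<in>K. if cyclic_clique n r A then ?g A * (f r - f (Suc r)) else 0)"
    by (subst sum.swap) (simp add: sum.distrib sum_distrib_right)
  also have "sum ?g K = 1"
    unfolding K_def using assms by (intro sum_subsets_card_sign[of _ 0]) auto
  also have "(\<Sum>r<n div 2. \<Sum>A\<in>K. if cyclic_clique n r A then ?g A * (f r - f (Suc r)) else 0) =
      (\<Sum>r<n div 2. if n - 2 * r dvd r then real (n - 2 * r) * (f r - f (Suc r)) else 0)"
  proof (rule sum.cong)
    fix r assume "r \<in> {..<n div 2}"
    then have r: "2 * int r + 2 \<le> int n" by auto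
    then have m: "int n - 2 * int r = int (n - 2 * r)" by auto
    have "(\<Sum>A\<in>K. if cyclic_clique n r A then ?g A * (f r - f (Suc r)) else 0) =
        (\<Sum>A | A \<noteq> {} \<and> A \<subseteq> ?X \<and> cyclic_clique n r A. ?g A) * (f r - f (Suc r))"
      using finK by (simp add: sum.If_cases sum_distrib_right K_def Int_def conj_assoc)
    also have "\<dots> = (if n - 2 * r dvd r then real (n - 2 * r) * (f r - f (Suc r)) else 0)"
      unfolding sum_cyclic_cliques[OF of_nat_0_le_iff r] m int_dvd_int_iff of_int_of_nat_eq by simp
    finally show "(\<Sum>A\<in>K. if cyclic_clique n r A then ?g A * (f r - f (Suc r)) else 0) =
        (if n - 2 * r dvd r then real (n - 2 * r) * (f r - f (Suc r)) else 0)" .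
  qed simp
  also have "\<dots> = (\<Sum>r | r < n div 2 \<and> n - 2 * r dvd r. real (n - 2 * r) * (f r - f (Suc r)))"
    by (simp add: sum.If_cases Int_def)
  finally show ?thesis by simp
qed

text \<open>The contribution of the scale \<open>r\<close> with \<open>n - 2 * r = n / k\<close>:
  the factor \<open>n / k\<close> is the Euler characteristic, and
  \<open>sin (pi * r / n) = cos (pi / (2 * k))\<close>.\<close>

definition divisor_term :: "real \<Rightarrow> nat \<Rightarrow> nat \<Rightarrow> real" where
  "divisor_term t n k =
     n / k * (exp (- 2 * t * cos (pi / (2 * k))) - exp (- 2 * t * cos (pi / (2 * k) - pi / n)))"

text \<open>If \<open>m = n - 2 * r\<close> divides \<open>r = m * q\<close>, then
  \<open>n = (2 * q + 1) * m\<close>, so \<open>k = 2 * q + 1\<close> is an odd divisor, and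
  \<open>r\<close> is recovered as \<open>(n - n / k) / 2\<close>. The condition
  \<open>r < n div 2\<close> means \<open>m \<ge> 2\<close>, that is \<open>k < n\<close>; for odd
  \<open>n\<close> the divisor \<open>k = n\<close> would belong to the top scale
  \<open>n div 2\<close>.\<close>

lemma rips_magnitude_cycle_divisors:
  fixes t :: real
  assumes "n > 0"
  shows "rips_magnitude (euclidean_cycle n) t = exp (- 2 * t * sin (pi * real (n div 2) / real n)) +
    (\<Sum>k | odd k \<and> k dvd n \<and> k < n. divisor_term t n k)"
proof -
  define f where "f r = exp (- 2 * t * sin (pi * r / n))" for r :: nat
  have "(\<Sum>r | r < n div 2 \<and> n - 2 * r dvd r. real (n - 2 * r) * (f r - f (Suc r))) =
      (\<Sum>k | odd k \<and> k dvd n \<and> k < n. divisor_term t n k)"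
  proof (rule sum.reindex_bij_witness[of _ "\<lambda>k. (n - n div k) div 2" "\<lambda>r. n div (n - 2 * r)"])
    fix r assume r: "r \<in> {r. r < n div 2 \<and> n - 2 * r dvd r}"
    define m where "m = n - 2 * r"
    have m: "m \<ge> 2" using r by (auto simp: m_def)
    obtain q where q: "r = m * q" using r unfolding m_def by blast
    have "n = 2 * r + m" using r by (auto simp: m_def)
    then have n: "n = (2 * q + 1) * m" unfolding q by (simp add: algebra_simps)
    have k: "n div (n - 2 * r) = 2 * q + 1"
      unfolding m_def[symmetric] using m by (subst n, intro nonzero_mult_div_cancel_right) simp
    show "(n - n div (n div (n - 2 * r))) div 2 = r"
    proof -
      have "n div (2 * q + 1) = m" unfolding n by (rule nonzero_mult_div_cancel_left) simp
      moreover have "n - m = 2 * r" using r by (auto simp: m_def)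
      ultimately show ?thesis unfolding k by simp
    qed
    show "n div (n - 2 * r) \<in> {k. odd k \<and> k dvd n \<and> k < n}"
    proof -
      have "(2 * q + 1) * 1 < (2 * q + 1) * m" using m by (intro mult_strict_left_mono) auto
      then show ?thesis unfolding k by (simp add: n del: mult_Suc)
    qed
    define a where "a = pi / (2 * real (2 * q + 1))"
    have "pi * r / n = (pi * q) * m / (real (2 * q + 1) * m)"
      unfolding q n of_nat_mult by (simp only: mult_ac)
    also have "\<dots> = pi * q / real (2 * q + 1)"
      using m by (intro mult_divide_mult_cancel_right) simp
    also have "\<dots> = pi / 2 - a" by (simp add: a_def field_simps)
    finally have ra: "pi * r / n = pi / 2 - a" .
    then have sr: "sin (pi * r / n) = cos a" by (simp add: sin_diff)
    have "pi * Suc r / n = pi / 2 - (a - pi / n)"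
      using ra by (simp add: distrib_left add_divide_distrib)
    then have sr': "sin (pi * Suc r / n) = cos (a - pi / n)"
      by (simp only: sin_cos_eq) simp
    have "real n / real (2 * q + 1) = real m"
      unfolding n of_nat_mult by (rule nonzero_mult_div_cancel_left) simp
    then show "divisor_term t n (n div (n - 2 * r)) = real (n - 2 * r) * (f r - f (Suc r))"
      unfolding k divisor_term_def f_def sr sr' a_def unfolding m_def[symmetric] by (simp only:)
  next
    fix k assume k: "k \<in> {k. odd k \<and> k dvd n \<and> k < n}"
    then obtain q where q: "k = 2 * q + 1" by (auto elim: oddE)
    obtain m where n: "n = k * m" using k by blast
    have m: "m \<ge> 2" using k n by (cases m; cases "m - 1") auto
    have nk: "n div k = m" unfolding n using q by (intro nonzero_mult_div_cancel_left) simp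
    have nr: "n - 2 * (q * m) = m" "n - m = 2 * (q * m)" by (simp_all add: n q algebra_simps)
    then have r: "(n - n div k) div 2 = q * m" unfolding nk by simp
    show "n div (n - 2 * ((n - n div k) div 2)) = k" unfolding r nr using n m by simp
    show "(n - n div k) div 2 \<in> {r. r < n div 2 \<and> n - 2 * r dvd r}"
      unfolding r using nr m by (auto simp: n q)
  qed
  then show ?thesis using rips_magnitude_cycle_filtration[OF assms, of t] by (simp add: f_def)
qed


section \<open>Asymptotics\<close>

definition series_term :: "real \<Rightarrow> nat \<Rightarrow> real" where
  "series_term t r = 1 / real r * exp (- 2 * t * cos (pi / (2 * real r))) * sin (pi / (2 * real r))"

lemma half_pi_div_nat:
  "0 \<le> pi / (2 * real k)" "pi / (2 * real k) \<le> pi / 2"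
  "0 \<le> sin (pi / (2 * real k))" "0 \<le> cos (pi / (2 * real k))"
proof -
  show 1: "0 \<le> pi / (2 * real k)" by simp
  show 2: "pi / (2 * real k) \<le> pi / 2"
  \<comment> \<open>For \<open>k = 0\<close> division by zero makes the angle
    \<open>0\<close>.\<close>
  proof (cases "k = 0")
    case False
    then show ?thesis by (intro divide_left_mono) auto
  qed simp
  have "0 \<le> sin x \<and> 0 \<le> cos x" if "0 \<le> x" "x \<le> pi / 2" for x
    using that by (auto intro!: sin_ge_zero cos_ge_zero)
  with 1 2 show "0 \<le> sin (pi / (2 * real k))" "0 \<le> cos (pi / (2 * real k))" by blast+
qed

lemma series_term_nonneg: "0 \<le> series_term t r"
  unfolding series_term_def by (intro mult_nonneg_nonneg half_pi_div_nat) auto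

lemma series_term_le:
  assumes "t \<ge> 0"
  shows "series_term t r \<le> pi / (2 * (real r)\<^sup>2)"
proof -
  have "0 \<le> t * cos (pi / (2 * real r))" using assms half_pi_div_nat by (intro mult_nonneg_nonneg)
  then have "exp (- 2 * t * cos (pi / (2 * real r))) \<le> 1" by simp
  moreover have "sin (pi / (2 * real r)) \<le> pi / (2 * real r)"
    by (rule sin_x_le_x[OF half_pi_div_nat(1)])
  ultimately have "exp (- 2 * t * cos (pi / (2 * real r))) * sin (pi / (2 * real r)) \<le> 1 * (pi / (2 * real r))"
    by (intro mult_mono half_pi_div_nat) auto
  then have "1 / real r * (exp (- 2 * t * cos (pi / (2 * real r))) * sin (pi / (2 * real r)))
      \<le> 1 / real r * (1 * (pi / (2 * real r)))"
    by (rule mult_left_mono) simp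
  then show ?thesis by (simp add: series_term_def power2_eq_square mult_ac)
qed

lemma series_term_summable:
  assumes "t \<ge> 0"
  shows "series_term t summable_on A"
proof -
  have "summable (\<lambda>r. pi / 2 * inverse ((real r)\<^sup>2))"
    by (intro summable_mult inverse_power_summable) auto
  then have "summable (\<lambda>r. pi / (2 * (real r)\<^sup>2))" by (simp add: field_simps)
  then have "summable (series_term t)"
    by (rule summable_comparison_test'[where N = 0])
       (use series_term_le[OF assms] series_term_nonneg in simp)
  then have "series_term t summable_on UNIV"
    using series_term_nonneg by (simp add: summable_on_UNIV_nonneg_real_iff)
  then show ?thesis by (rule summable_on_subset_banach) simp
qed

lemma DERIV_exp_cos: "DERIV (\<lambda>x. exp (- 2 * t * cos x)) x :> 2 * t * sin x * exp (- 2 * t * cos x)"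
  by (auto intro!: derivative_eq_intros)

text \<open>By the mean value theorem the difference of \<open>h x = exp (- 2 * t * cos x)\<close>
  over an interval of length \<open>pi / n\<close> is that length times \<open>h' z\<close>. Both
  \<open>sin\<close> and \<open>h\<close> are nonnegative and nondecreasing on
  \<open>[0, pi / 2]\<close>, so \<open>h' z\<close> lies between \<open>0\<close> and
  \<open>h'\<close> at the right end. The bound \<open>2 * k \<le> n\<close> keeps the left end
  nonnegative.\<close>

lemma divisor_term_bounds:
  assumes t: "t \<ge> 0" and k: "k \<ge> 1" "2 * k \<le> n"
  shows "0 \<le> divisor_term t n k" "divisor_term t n k \<le> 2 * pi * t * series_term t k"
proof -
  define a b where "a = pi / (2 * real k)" and "b = a - pi / n"
  let ?h = "\<lambda>x. exp (- 2 * t * cos x)"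
  have a: "a \<le> pi / 2" unfolding a_def by (rule half_pi_div_nat)
  have n: "real n > 0" using k by simp
  have "pi / n \<le> a" unfolding a_def using k by (intro divide_left_mono) auto
  then have b: "0 \<le> b" "b < a" using n by (auto simp: b_def)
  obtain z where z: "b < z" "z < a" "?h a - ?h b = (a - b) * (2 * t * sin z * ?h z)"
    using MVT2[OF b(2) DERIV_exp_cos] by blast
  have sin: "0 \<le> sin z" "sin z \<le> sin a"
    using z a b by (auto intro!: sin_ge_zero sin_monotone_2pi_le)
  have "cos a \<le> cos z" using z a b by (intro cos_monotone_0_pi_le) auto
  then have "?h z \<le> ?h a" using t by (simp add: mult_left_mono)
  then have "2 * t * sin z * ?h z \<le> 2 * t * sin a * ?h a"
    using sin t by (intro mult_mono) auto
  then have "(a - b) * (2 * t * sin z * ?h z) \<le> (a - b) * (2 * t * sin a * ?h a)"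
    using b by (intro mult_left_mono) auto
  then have "divisor_term t n k \<le> n / k * ((a - b) * (2 * t * sin a * ?h a))"
    unfolding divisor_term_def a_def[symmetric] b_def[symmetric] z(3)
    by (rule mult_left_mono) simp
  also have "\<dots> = 2 * pi * t * series_term t k"
    using n unfolding series_term_def a_def[symmetric] b_def by simp
  finally show "divisor_term t n k \<le> 2 * pi * t * series_term t k" .
  show "0 \<le> divisor_term t n k"
    unfolding divisor_term_def a_def[symmetric] b_def[symmetric] z(3)
    using sin t b by (intro mult_nonneg_nonneg) auto
qed

text \<open>Up to the factor \<open>pi / k\<close>, the term is the difference quotient of
  \<open>exp (- 2 * t * cos x)\<close> at \<open>pi / (2 * k)\<close> with step
  \<open>- pi / n\<close>.\<close>

lemma divisor_term_tendsto:
  "(\<lambda>n. divisor_term t n k) \<longlonglongrightarrow> 2 * pi * t * series_term t k"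
proof -
  define a where "a = pi / (2 * real k)"
  let ?h = "\<lambda>x. exp (- 2 * t * cos x)"
  have "(\<lambda>n. - (pi / real n)) \<longlonglongrightarrow> - 0"
    by (intro tendsto_minus lim_const_over_n)
  then have "filterlim (\<lambda>n. - (pi / real n)) (at 0) sequentially"
    by (intro filterlim_atI) (auto intro: eventually_mono[OF eventually_gt_at_top[of 0]])
  moreover have "((\<lambda>e. (?h (a + e) - ?h a) / e) \<longlongrightarrow> 2 * t * sin a * ?h a) (at 0)"
    using DERIV_exp_cos[of t a] by (simp add: DERIV_def)
  ultimately have "(\<lambda>n. (?h (a + - (pi / real n)) - ?h a) / - (pi / real n)) \<longlonglongrightarrow> 2 * t * sin a * ?h a"
    by (rule filterlim_compose[rotated])
  then have "(\<lambda>n. pi / k * ((?h (a + - (pi / real n)) - ?h a) / - (pi / real n)))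
      \<longlonglongrightarrow> pi / k * (2 * t * sin a * ?h a)"
    by (intro tendsto_intros)
  moreover have "pi / k * ((u - v) / - (pi / real n)) = n / k * (v - u)" for n and u v :: real
    by (cases "n = 0"; cases "k = 0") (simp_all add: field_simps)
  then have "pi / k * ((?h (a + - (pi / real n)) - ?h a) / - (pi / real n)) = divisor_term t n k" for n
    by (simp add: divisor_term_def a_def[symmetric])
  ultimately show ?thesis
    unfolding series_term_def a_def[symmetric] by (simp add: mult_ac)
qed

lemma half_floor_tendsto: "(\<lambda>n. real (n div 2) / n) \<longlonglongrightarrow> 1 / 2"
proof (rule tendsto_sandwich)
  show "\<forall>\<^sub>F n in sequentially. 1 / 2 - 1 / real n \<le> real (n div 2) / n"
    using eventually_gt_at_top[of 0]
  proof eventually_elim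
    case (elim n)
    have "n \<le> 2 * (n div 2) + 2" by presburger
    then have "real n \<le> 2 * real (n div 2) + 2" by linarith
    then have "(real n - 2) / 2 / n \<le> real (n div 2) / n" by (intro divide_right_mono) auto
    moreover have "(real n - 2) / 2 / n = 1 / 2 - 1 / n" using elim by (simp add: field_simps)
    ultimately show ?case by simp
  qed
  show "\<forall>\<^sub>F n in sequentially. real (n div 2) / n \<le> 1 / 2"
    using eventually_gt_at_top[of 0]
  proof eventually_elim
    case (elim n)
    have "2 * (n div 2) \<le> n" by presburger
    then have "2 * real (n div 2) \<le> real n" by linarith
    then show ?case using elim by (simp add: field_simps)
  qed
  show "(\<lambda>n. 1 / 2 - 1 / real n) \<longlonglongrightarrow> 1 / 2"
    using tendsto_diff[OF tendsto_const[of "1/2::real"] lim_1_over_n] by simp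
qed simp

lemma top_scale_tendsto:
  "(\<lambda>n. exp (- 2 * t * sin (pi * real (n div 2) / real n))) \<longlonglongrightarrow> exp (- 2 * t)"
proof -
  have "(\<lambda>n. exp (- 2 * t * sin (pi * (real (n div 2) / n)))) \<longlonglongrightarrow> exp (- 2 * t * sin (pi * (1 / 2)))"
    by (intro tendsto_intros half_floor_tendsto)
  then show ?thesis by (simp only: times_divide_eq_right mult_1_right sin_pi_half)
qed

lemma proper_divisor_double_le:
  fixes k n :: nat
  assumes "k dvd n" "k < n"
  shows "2 * k \<le> n"
proof -
  obtain m where m: "n = k * m" using assms by blast
  with assms have "m \<ge> 2" by (cases m; cases "m - 1") auto
  then show ?thesis unfolding m by (simp add: mult.commute)
qed

section \<open>Lower and upper limits\<close>

text \<open>Every term is bounded by its limit, and the divisors are then enlarged to all odd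
  numbers, the series having nonnegative terms. Only the first exponential still depends on
  \<open>n\<close>.\<close>

lemma rips_magnitude_cycle_upper:
  assumes "t \<ge> 0" "n > 0"
  shows "rips_magnitude (euclidean_cycle n) t \<le>
    exp (- 2 * t * sin (pi * real (n div 2) / real n)) + 2 * pi * t * infsum (series_term t) {r. odd r}"
proof -
  let ?D = "{k. odd k \<and> k dvd n \<and> k < n}"
  have "(\<Sum>k\<in>?D. divisor_term t n k) \<le> (\<Sum>k\<in>?D. 2 * pi * t * series_term t k)"
    using assms proper_divisor_double_le by (intro sum_mono divisor_term_bounds) (auto elim: oddE)
  also have "\<dots> = 2 * pi * t * (\<Sum>k\<in>?D. series_term t k)" by (simp add: sum_distrib_left)
  also have "\<dots> \<le> 2 * pi * t * infsum (series_term t) {r. odd r}"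
    using assms series_term_summable series_term_nonneg
    by (intro mult_left_mono finite_sum_le_infsum) auto
  finally show ?thesis using rips_magnitude_cycle_divisors[OF assms(2), of t] by simp
qed

lemma rips_magnitude_cycle_lower:
  assumes "t \<ge> 0" "n > 0" and J: "\<And>k. k \<in> J \<Longrightarrow> odd k \<and> k dvd n \<and> k < n"
  shows "exp (- 2 * t * sin (pi * real (n div 2) / real n)) + (\<Sum>k\<in>J. divisor_term t n k) \<le>
    rips_magnitude (euclidean_cycle n) t"
  unfolding rips_magnitude_cycle_divisors[OF assms(2)]
  using assms proper_divisor_double_le
  by (intro add_left_mono sum_mono2 divisor_term_bounds) (auto elim: oddE)

lemma liminf_rips_magnitude_cycle:
  assumes "t \<ge> 0"
  shows "liminf (\<lambda>n. ereal (rips_magnitude (euclidean_cycle n) t)) = ereal (exp (- 2 * t) + 2 * pi * t)"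
    (is "liminf ?X = ?L")
proof (rule antisym)
  let ?e = "\<lambda>n. exp (- 2 * t * sin (pi * real (n div 2) / real n)) + divisor_term t n 1"
  \<comment> \<open>At \<open>k = 1\<close> the angle is \<open>pi / 2\<close>, with cosine
    \<open>0\<close> and sine \<open>1\<close>.\<close>
  have "series_term t 1 = 1" by (simp add: series_term_def)
  then have lim: "(\<lambda>n. ereal (?e n)) \<longlonglongrightarrow> ?L"
    using tendsto_add[OF top_scale_tendsto divisor_term_tendsto[of t 1]] by simp
  have "?L = liminf (\<lambda>n. ereal (?e n))"
    using lim_imp_Liminf[OF _ lim] by simp
  also have "\<dots> \<le> liminf ?X"
  proof (rule Liminf_mono)
    show "\<forall>\<^sub>F n in sequentially. ereal (?e n) \<le> ?X n"
      using eventually_gt_at_top[of 1]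
    proof eventually_elim
      case (elim n)
      then show ?case using rips_magnitude_cycle_lower[of t n "{1}"] assms by simp
    qed
  qed
  finally show "?L \<le> liminf ?X" .
  \<comment> \<open>Along these powers of two \<open>1\<close> is the only odd divisor; the exponent
    \<open>Suc j\<close> makes it a proper one.\<close>
  define s where "s j = (2::nat) ^ Suc j" for j
  have s: "strict_mono s" by (auto simp: s_def strict_mono_Suc_iff)
  have "{k. odd k \<and> k dvd s j \<and> k < s j} = {1}" for j
  proof -
    have "k = 1" if "odd k" "k dvd s j" for k
    proof -
      have "coprime k (s j)" unfolding s_def using that(1) by simp
      then show ?thesis using that(2) by (simp add: coprime_absorb_left)
    qed
    moreover have "1 < s j" unfolding s_def by (rule one_less_power) auto
    ultimately show ?thesis by auto
  qed
  then have Xs: "?X \<circ> s = (\<lambda>n. ereal (?e n)) \<circ> s"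
    by (auto simp: rips_magnitude_cycle_divisors s_def simp del: power_Suc)
  have "liminf ?X \<le> liminf (?X \<circ> s)" by (rule liminf_subseq_mono[OF s])
  also have "\<dots> = ?L"
    unfolding Xs using LIMSEQ_subseq_LIMSEQ[OF lim s] by (intro lim_imp_Liminf) auto
  finally show "liminf ?X \<le> ?L" .
qed

lemma limsup_rips_magnitude_cycle:
  assumes "t \<ge> 0"
  shows "limsup (\<lambda>n. ereal (rips_magnitude (euclidean_cycle n) t)) =
    ereal (exp (- 2 * t) + 2 * pi * t * infsum (series_term t) {r. odd r})"
    (is "limsup ?X = ereal (?c + ?p * ?S)")
proof (rule antisym)
  let ?e = "\<lambda>n. exp (- 2 * t * sin (pi * real (n div 2) / real n))"
  have "limsup ?X \<le> limsup (\<lambda>n. ereal (?e n + ?p * ?S))"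
  proof (rule Limsup_mono)
    show "\<forall>\<^sub>F n in sequentially. ?X n \<le> ereal (?e n + ?p * ?S)"
      using eventually_gt_at_top[of 0]
      by eventually_elim (use rips_magnitude_cycle_upper assms in auto)
  qed
  also have "\<dots> = ereal (?c + ?p * ?S)"
    by (intro lim_imp_Limsup tendsto_ereal tendsto_add top_scale_tendsto) auto
  finally show "limsup ?X \<le> ereal (?c + ?p * ?S)" .
  have partial: "ereal (?c + ?p * sum (series_term t) J) \<le> limsup ?X"
    if J: "finite J" "J \<subseteq> {r. odd r}" for J
  proof -
    \<comment> \<open>Every element of \<open>J\<close> divides \<open>\<Prod>J\<close>; the factor
      \<open>2\<close> makes it a proper divisor, and \<open>Suc j\<close> makes the sequence
      strictly increasing.\<close>
    define s where "s j = 2 * \<Prod>J * Suc j" for j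
    have pos: "\<Prod>J > 0" using J by (intro prod_pos) (auto intro: odd_pos)
    then have s: "strict_mono s" by (auto simp: s_def strict_mono_Suc_iff)
    have dvd: "odd k \<and> k dvd s j \<and> k < s j" if "k \<in> J" for j k
    proof -
      have "k dvd \<Prod>J" using J that by (simp add: dvd_prodI[where f = "\<lambda>x. x"])
      moreover from this have "k \<le> \<Prod>J" using pos by (rule dvd_imp_le)
      ultimately show ?thesis using that J pos by (auto simp: s_def)
    qed
    let ?l = "\<lambda>n. ?e n + (\<Sum>k\<in>J. divisor_term t n k)"
    have "?l \<longlonglongrightarrow> ?c + (\<Sum>k\<in>J. ?p * series_term t k)"
      by (intro tendsto_add tendsto_sum top_scale_tendsto divisor_term_tendsto)
    from LIMSEQ_subseq_LIMSEQ[OF this s]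
    have "(\<lambda>j. ?l (s j)) \<longlonglongrightarrow> ?c + ?p * sum (series_term t) J"
      unfolding o_def sum_distrib_left .
    then have "ereal (?c + ?p * sum (series_term t) J) = limsup (\<lambda>j. ereal (?l (s j)))"
      by (intro lim_imp_Limsup[symmetric] tendsto_ereal) auto
    also have "\<dots> \<le> limsup (?X \<circ> s)"
    proof (intro Limsup_mono always_eventually allI)
      fix j
      have "s j > 0" using pos by (simp add: s_def)
      then show "ereal (?l (s j)) \<le> (?X \<circ> s) j"
        using rips_magnitude_cycle_lower[OF assms, of "s j" J] dvd by simp
    qed
    also have "\<dots> \<le> limsup ?X" by (rule limsup_subseq_mono[OF s])
    finally show ?thesis .
  qed
  \<comment> \<open>The finite partial sums converge to the infinite sum along the net of finite
    subsets, so the bound \<open>partial\<close> passes to the limit.\<close>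
  have "(sum (series_term t) \<longlongrightarrow> ?S) (finite_subsets_at_top {r. odd r})"
    using has_sum_infsum[OF series_term_summable[OF assms]] by (simp add: has_sum_def)
  then have "((\<lambda>J. ereal (?c + ?p * sum (series_term t) J)) \<longlongrightarrow> ereal (?c + ?p * ?S))
      (finite_subsets_at_top {r. odd r})"
    by (intro tendsto_intros tendsto_ereal)
  then show "ereal (?c + ?p * ?S) \<le> limsup ?X"
    by (rule tendsto_upperbound)
       (rule eventually_finite_subsets_at_top_weakI, rule partial, auto)
qed

theorem theorem9p3:
  fixes t :: real
  assumes "t > 0"
  shows "(liminf (\<lambda>n. ereal (rips_magnitude (euclidean_cycle n) t))
           = ereal (exp (- 2 * t) + 2 * pi * t)) \<and>
         (limsup (\<lambda>n. ereal (rips_magnitude (euclidean_cycle n) t))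
           = ereal (exp (- 2 * t) + 2 * pi * t *
               (\<Sum>\<^sub>\<infinity>r\<in>{r::nat. odd r}.
                  1 / real r * exp (- 2 * t * cos (pi / (2 * real r))) * sin (pi / (2 * real r))))) \<and>
         (Infinite_Sum.abs_summable_on
           (\<lambda>r::nat. 1 / real r * exp (- 2 * t * cos (pi / (2 * real r))) * sin (pi / (2 * real r)))
           {r. odd r}) \<and>
         (\<forall>r::nat. odd r \<longrightarrow>
           \<bar>1 / real r * exp (- 2 * t * cos (pi / (2 * real r))) * sin (pi / (2 * real r))\<bar>
             \<le> pi / (2 * (real r)\<^sup>2))"
  \<comment> \<open>As \<open>series_term\<close> is nonnegative, absolute summability is plain
    summability and the absolute value in the bound drops out.\<close>
  using assms liminf_rips_magnitude_cycle[of t] limsup_rips_magnitude_cycle[of t]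
    series_term_summable[of t] series_term_le[of t] series_term_nonneg[of t]
  unfolding series_term_def[symmetric] by simp

end
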